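(* Let $q\ge2$ be an integer. Then the function $f:\mathbb{Z}_q^2\to\mathbb{Z}_{2q}$ defined by $$f(x_1,x_2)=2\hat{x}_1\hat{x}_2+\hat{x}_1 \pmod{2q}$$ is a $2q$-negabent function.
   Context: $\mathbb{Z}_m$ is the ring of integers modulo $m$. For $x\in\mathbb{Z}_q$, $\hat{x}\in\{0,\ldots,q-1\}$ is its least non-negative integer representative, and $\hat{\mathbf{x}}=(\hat{x}_1,\ldots,\hat{x}_n)$. Let $\xi$ be a primitive $q$-th root of unity and $\omega$ a primitive $2q$-th root of unity; $\langle\hat{\mathbf{x}},\hat{\mathbf{u}}\rangle=\sum_i\hat x_i\hat u_i$. The $2q$-nega-Hadamard transform of $f:\mathbb{Z}_q^n\to\mathbb{Z}_{2q}$ is $\mathcal{N}_f(\mathbf{u})=q^{-n/2}\sum_{\mathbf{x}\in\mathbb{Z}_q^n}\omega^{f(\mathbf{x})}\xi^{\langle\hat{\mathbf{x}},\hat{\mathbf{u}}\rangle}\omega^{\sum_i\hat{x}_i}$, and $f$ is $2q$-negabent if $|\mathcal{N}_f(\mathbf{u})|=1$ for all $\mathbf{u}\in\mathbb{Z}_q^n$. *)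

theory Defs
  imports Complex_Main "HOL-Library.FuncSet" "HOL-Number_Theory.Residues"
begin

(* The library's residue_ring m has carrier {0..m - 1}, i.e. a residue class modulo m is
   its least non-negative representative.  The map from x to x-hat is therefore the inclusion
   of the carrier into the integers and does not appear in the formulas below. *)

abbreviation Zmod :: "nat \<Rightarrow> int set" where
  "Zmod m \<equiv> carrier (residue_ring (int m))"

(* Coordinates are indexed by 1, ..., n; extensionality outside {1..n} makes each
   vector a unique function. *)
definition Zvec :: "nat \<Rightarrow> nat \<Rightarrow> (nat \<Rightarrow> int) set" where
  "Zvec q n = {1..n} \<rightarrow>\<^sub>E Zmod q"

definition primitive_root_of_unity :: "nat \<Rightarrow> complex \<Rightarrow> bool" where
  "primitive_root_of_unity m z \<longleftrightarrow> m > 0 \<and> z ^ m = 1 \<and> (\<forall>k. 0 < k \<and> k < m \<longrightarrow> z ^ k \<noteq> 1)"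

definition nega_Hadamard ::
    "complex \<Rightarrow> complex \<Rightarrow> nat \<Rightarrow> nat \<Rightarrow> ((nat \<Rightarrow> int) \<Rightarrow> int) \<Rightarrow> (nat \<Rightarrow> int) \<Rightarrow> complex" where
  "nega_Hadamard \<xi> \<omega> q n f u =
     of_real (real q powr (- (real n / 2))) *
     (\<Sum>x\<in>Zvec q n. \<omega> powi f x * \<xi> powi (\<Sum>i=1..n. x i * u i) * \<omega> powi (\<Sum>i=1..n. x i))"

definition negabent ::
    "complex \<Rightarrow> complex \<Rightarrow> nat \<Rightarrow> nat \<Rightarrow> ((nat \<Rightarrow> int) \<Rightarrow> int) \<Rightarrow> bool" where
  "negabent \<xi> \<omega> q n f \<longleftrightarrow>
     f \<in> Zvec q n \<rightarrow> Zmod (2 * q) \<and> (\<forall>u\<in>Zvec q n. norm (nega_Hadamard \<xi> \<omega> q n f u) = 1)"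

end

theory Submission
  imports Defs
begin

text \<open>
  In the double sum defining the transform, the variable \<open>x\<^sub>1\<close> occurs only through the powers of
  \<open>\<omega>\<^bsup>2(x\<^sub>2 + 1)\<^esup> \<xi>\<^bsup>u\<^sub>1\<^esup>\<close>, a \<open>q\<close>-th root of unity. Summing over \<open>x\<^sub>1\<close> first therefore gives \<open>q\<close> for the
  unique \<open>x\<^sub>2\<close> that makes this root equal to \<open>1\<close>, and \<open>0\<close> for all others, so exactly one term
  of absolute value \<open>q\<close> survives.
\<close>

lemma primitive_root_of_unity_pow_inj_on:
  assumes "primitive_root_of_unity m z"
  shows "inj_on (\<lambda>k. z ^ k) {..<m}"
proof (rule linorder_inj_onI')
  fix i j assume ij: "i \<in> {..<m}" "j \<in> {..<m}" "i < j"
  have "z \<noteq> 0"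
    using assms by (auto simp: primitive_root_of_unity_def power_0_left)
  moreover have "z ^ (j - i) \<noteq> 1"
    using assms ij by (auto simp: primitive_root_of_unity_def)
  moreover have "z ^ j = z ^ i * z ^ (j - i)"
    using ij by (simp flip: power_add)
  ultimately show "z ^ i \<noteq> z ^ j" by simp
qed

lemma primitive_root_of_unity_square:
  assumes "primitive_root_of_unity (2 * m) z"
  shows "primitive_root_of_unity m (z\<^sup>2)"
  using assms by (auto simp: primitive_root_of_unity_def simp flip: power_mult)

lemma sum_powers_root_of_unity:
  fixes z :: complex
  assumes "z ^ m = 1"
  shows "(\<Sum>k<m. z ^ k) = (if z = 1 then of_nat m else 0)"
  using assms by (simp add: sum_gp_strict)

text \<open>The \<open>m\<close> values \<open>z ^ (k + 1) * c\<close> are \<open>m\<close>-th roots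
  of unity, and they are distinct because \<open>z\<close> is primitive and \<open>z\<close>,
  \<open>c\<close> are nonzero. As there are exactly \<open>m\<close> such roots, all are attained
  once, including 1.\<close>

lemma ex1_shifted_primitive_power:
  assumes z: "primitive_root_of_unity m z" and c: "c ^ m = 1"
  shows "\<exists>!k. k < m \<and> z ^ (k + 1) * c = 1"
proof -
  have m: "m > 0" and zm: "z ^ m = 1"
    using z by (auto simp: primitive_root_of_unity_def)
  have nz: "z \<noteq> 0" "c \<noteq> 0"
    using m zm c by (auto simp: power_0_left)
  let ?g = "\<lambda>k. z ^ (k + 1) * c"
  have inj: "inj_on ?g {..<m}"
    using primitive_root_of_unity_pow_inj_on[OF z] nz by (auto simp: inj_on_def)
  have root: "?g k ^ m = 1" for k
  proof -
    have "?g k ^ m = (z ^ m) ^ (k + 1) * c ^ m"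
      by (simp only: power_mult_distrib power_mult[symmetric] mult.commute)
    then show ?thesis using zm c by simp
  qed
  have "?g ` {..<m} = {w. w ^ m = 1}"
  proof (rule card_subset_eq)
    show "finite {w::complex. w ^ m = 1}"
      using m by (intro finite_roots_unity) simp
    show "?g ` {..<m} \<subseteq> {w. w ^ m = 1}"
      using root by blast
    show "card (?g ` {..<m}) = card {w::complex. w ^ m = 1}"
      using m card_image[OF inj] by (simp add: card_roots_unity_eq)
  qed
  then have "1 \<in> ?g ` {..<m}" by simp
  then obtain k where k: "k < m" "?g k = 1" by auto
  show ?thesis
  proof (rule ex1I[of _ k])
    show "k' = k" if "k' < m \<and> ?g k' = 1" for k'
    proof (rule inj_onD[OF inj])
      show "?g k' = ?g k" using that k by (simp only:)
    qed (use that k in auto)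
  qed (use k in simp)
qed

text \<open>Serves to drop the reduction modulo \<open>2 * q\<close> when a value of the function
  stands in the exponent of \<omega>.\<close>

lemma power_int_mod_period:
  fixes z :: complex
  assumes "z ^ m = 1" "m > 0"
  shows "z powi (k mod int m) = z powi k"
proof -
  have "z \<noteq> 0" using assms by (auto simp: power_0_left)
  have "z powi k = z powi (int m * (k div int m) + k mod int m)"
    by simp
  also have "\<dots> = z powi (k mod int m)"
    using assms(1) \<open>z \<noteq> 0\<close> by (subst power_int_add) (simp_all add: power_int_mult)
  finally show ?thesis ..
qed

lemma Zvec_2_nthE:
  assumes "x \<in> Zvec q 2"
  obtains a b where "a < q" "b < q" "x 1 = int a" "x 2 = int b"
proof -
  have "x 1 \<in> {0..int q - 1}" "x 2 \<in> {0..int q - 1}"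
    using assms by (auto simp: Zvec_def PiE_iff residue_ring_def)
  then show ?thesis
    by (intro that[of "nat (x 1)" "nat (x 2)"]) auto
qed

text \<open>The first coordinate \<open>a\<close> is placed in the inner sum, where the summand will
  be geometric.\<close>

lemma sum_Zvec_2:
  "(\<Sum>x\<in>Zvec q 2. h (x 1) (x 2)) = (\<Sum>b<q. \<Sum>a<q. h (int a) (int b))"
proof -
  have "(\<Sum>x\<in>Zvec q 2. h (x 1) (x 2)) = (\<Sum>(b, a)\<in>{..<q} \<times> {..<q}. h (int a) (int b))"
  \<comment> \<open>Extensionality forces the value \<open>undefined\<close> at indices other than 1
    and 2.\<close>
  proof (rule sum.reindex_bij_witness[where
        j = "\<lambda>x. (nat (x 2), nat (x 1))" and
        i = "\<lambda>(b, a) i. if i = 1 then int a else if i = 2 then int b else undefined"])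
    fix x assume x: "x \<in> Zvec q 2"
    obtain a b where ab: "a < q" "b < q" "x 1 = int a" "x 2 = int b"
      using x by (rule Zvec_2_nthE)
    have "x i = undefined" if "i \<noteq> 1" "i \<noteq> 2" for i
      using x that by (auto simp: Zvec_def PiE_iff extensional_def)
    then show "(case (nat (x 2), nat (x 1)) of (b, a) \<Rightarrow>
        \<lambda>i. if i = 1 then int a else if i = 2 then int b else undefined) = x"
      using ab by (auto simp: fun_eq_iff)
    show "(nat (x 2), nat (x 1)) \<in> {..<q} \<times> {..<q}"
      using ab by simp
    show "(case (nat (x 2), nat (x 1)) of (b, a) \<Rightarrow> h (int a) (int b)) = h (x 1) (x 2)"
      using ab by simp
  next
    fix p assume "p \<in> {..<q} \<times> {..<q}"
    then show "(case p of (b, a) \<Rightarrow>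
        \<lambda>i. if i = 1 then int a else if i = 2 then int b else undefined) \<in> Zvec q 2"
      by (auto simp: Zvec_def PiE_iff residue_ring_def extensional_def)
  qed auto
  then show ?thesis
    by (simp add: sum.cartesian_product)
qed

theorem theorem8:
  fixes q :: nat and \<xi> \<omega> :: complex
  assumes "q \<ge> 2"
    and "primitive_root_of_unity q \<xi>"
    and "primitive_root_of_unity (2 * q) \<omega>"
  shows "negabent \<xi> \<omega> q 2 (\<lambda>x. (2 * x 1 * x 2 + x 1) mod (2 * int q))"
proof -
  let ?f = "\<lambda>x::nat \<Rightarrow> int. (2 * x 1 * x 2 + x 1) mod (2 * int q)"
  have q: "q > 0" using assms(1) by simp
  have \<xi>: "\<xi> ^ q = 1" and \<omega>: "\<omega> ^ (2 * q) = 1"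
    using assms(2,3) by (auto simp: primitive_root_of_unity_def)
  have "norm (nega_Hadamard \<xi> \<omega> q 2 ?f u) = 1" if u_mem: "u \<in> Zvec q 2" for u
  proof -
    obtain r s where u: "u 1 = int r" "u 2 = int s"
      using u_mem by (rule Zvec_2_nthE)
    \<comment> \<open>The ratio of the geometric sum over \<open>a\<close>: the part of the exponent
      of \<omega> that involves \<open>a\<close> is
      \<open>2 * a * b + a + a = 2 * a * (b + 1)\<close>. Its evenness makes \<open>w b\<close> a
      \<open>q\<close>-th root of unity.\<close>
    define w where "w = (\<lambda>b. (\<omega>\<^sup>2) ^ (b + 1) * \<xi> ^ r)"
    have "(\<xi> ^ r) ^ q = 1"
      using \<xi> by (metis mult.commute power_mult power_one)
    from ex1_shifted_primitive_power[OF primitive_root_of_unity_square[OF assms(3)] this]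
    obtain k where k: "k < q" and w_eq_1_iff: "\<And>b. b < q \<Longrightarrow> w b = 1 \<longleftrightarrow> b = k"
      unfolding w_def by blast
    have w: "w b ^ q = 1" for b
    proof -
      have "w b ^ q = (\<omega> ^ (2 * q)) ^ (b + 1) * (\<xi> ^ q) ^ r"
        by (simp only: w_def power_mult_distrib power_mult[symmetric] mult_ac)
      then show ?thesis using \<omega> \<xi> by simp
    qed
    \<comment> \<open>The factor of the summand that does not depend on \<open>a\<close>.\<close>
    define t where "t = (\<lambda>b. \<omega> ^ b * \<xi> ^ (b * s))"
    have summand: "\<omega> powi ((2 * int a * int b + int a) mod (2 * int q)) *
        \<xi> powi (int a * u 1 + int b * u 2) * \<omega> powi (int a + int b) = t b * w b ^ a" for a b
    proof -
      have "\<omega> powi ((2 * int a * int b + int a) mod (2 * int q)) = \<omega> powi int (2 * a * b + a)"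
        using power_int_mod_period[OF \<omega>, of "int (2 * a * b + a)"] q by simp
      moreover have "int a * u 1 + int b * u 2 = int (a * r + b * s)"
        unfolding u by simp
      moreover have "int a + int b = int (a + b)"
        by simp
      \<comment> \<open>One factor \<open>\<omega> ^ a\<close> comes from the linear term of
        \<open>?f\<close>, the other from the weight
        \<open>\<omega> powi (int a + int b)\<close>.\<close>
      moreover have "\<omega> ^ (a * 2) = \<omega> ^ a * \<omega> ^ a"
        by (simp add: mult_2_right power_add)
      ultimately show ?thesis
        unfolding t_def w_def
        by (simp only: power_int_of_nat)
           (simp add: power_add power_mult_distrib algebra_simps flip: power_mult)
    qed
    have sum_12: "(\<Sum>i=1..2. g i) = g 1 + g 2" for g :: "nat \<Rightarrow> int"
      by (simp add: numeral_2_eq_2)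
    have "(\<Sum>x\<in>Zvec q 2. \<omega> powi ?f x * \<xi> powi (\<Sum>i=1..2. x i * u i) * \<omega> powi (\<Sum>i=1..2. x i))
        = (\<Sum>b<q. \<Sum>a<q. t b * w b ^ a)"
      using sum_Zvec_2[where q = q and h = "\<lambda>x y. \<omega> powi ((2 * x * y + x) mod (2 * int q)) *
        \<xi> powi (x * u 1 + y * u 2) * \<omega> powi (x + y)"]
      unfolding sum_12 summand .
    also have "\<dots> = (\<Sum>b<q. t b * (if w b = 1 then of_nat q else 0))"
      by (simp only: sum_distrib_left[symmetric] sum_powers_root_of_unity[OF w])
    also have "\<dots> = (\<Sum>b<q. if b = k then t k * of_nat q else 0)"
      by (intro sum.cong) (simp_all add: w_eq_1_iff)
    also have "\<dots> = t k * of_nat q"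
      using k by simp
    \<comment> \<open>With two coordinates the normalising factor is \<open>q powr (-1)\<close>,
      which cancels the \<open>q\<close> from the surviving inner sum.\<close>
    finally have "nega_Hadamard \<xi> \<omega> q 2 ?f u = of_real (1 / real q) * (t k * of_nat q)"
      using q by (simp add: nega_Hadamard_def powr_minus divide_inverse)
    \<comment> \<open>A complex number with a positive power equal to 1 has norm 1, and
      \<open>q > 0\<close> makes both exponents positive.\<close>
    moreover have "norm (t k) = 1"
      using power_eq_1_iff[OF \<omega>] power_eq_1_iff[OF \<xi>] q
      by (simp add: t_def norm_mult norm_power)
    ultimately show ?thesis
      using q by (simp add: norm_mult norm_divide)
  qed
  then show ?thesis
    using q by (auto simp: negabent_def residue_ring_def)
qed

end
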